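(* Let $U\Subset(0,\infty)$, let $\gamma\in\mathbb{R}$, and let $z=z(h)$ be resonances defined along a sequence $h=h_j\to 0^+$ such that $\operatorname{Re} z\in U$ and $\operatorname{Im} z=-\gamma h\log(1/h)+O(h)$ as $h=h_j\to 0$. Then $\gamma\in\Gamma$.
   Context: Setting. Fix an integer $N\ge 2$ and real parameters $x_1<\dots<x_N$, $C_j\neq 0$, $\beta_j>0$ ($1\le j\le N$). For $h>0$ put $V(x)=\sum_{j=1}^N C_jh^{1+\beta_j}\delta(x-x_j)$ on $\mathbb{R}$. Resonances. A resonance (for a given $h>0$) is a $z\in\mathbb{C}\setminus\{0\}$ for which $(-h^2\partial_x^2+V-z^2)u=0$ has a nonzero outgoing solution. Explicitly (with $x_0=-\infty$, $x_{N+1}=+\infty$): there are coefficients $v_j^\pm$, not all zero, with $v_0^+=v_N^-=0$, such that $u(x)=v_j^+e^{izx/h}+v_j^-e^{-izx/h}$ on $(x_j,x_{j+1})$ for $0\le j\le N$ satisfies $u(x_j^-)=u(x_j^+)$ and $h^2\big(u'(x_j^-)-u'(x_j^+)\big)+C_jh^{1+\beta_j}u(x_j)=0$ for $1\le j\le N$. Newton polygon. Let $P=\{(2(x_k-x_j),\,\beta_j+\beta_k):1\le j<k\le N\}\cup\{(0,0)\}\subset\mathbb{R}^2$, with points written $(\lambda,\nu)$. The Newton polygon is the convex hull of the epigraph $\{(\lambda,t):(\lambda,\nu)\in P,\ t\ge\nu\}$. $\Gamma$ is the (finite) set of slopes of the non-vertical edges of the boundary of this Newton polygon. Standing assumption.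 The non-infinite slopes of the Newton polygon are unique, in the sense that among any three distinct collinear points of $P$ at least one lies in the interior of the Newton polygon. *)

theory Defs
  imports "HOL-Analysis.Analysis" "HOL-Library.Landau_Symbols"
begin

text \<open>
  The data are sequences \<open>x\<close>, \<open>C\<close>, \<open>\<beta>\<close>, of which only the entries with index in
  \<open>{1..N}\<close> are used.  The conventions \<open>x\<^sub>0 = -\<infinity>\<close> and \<open>x\<^sub>N\<^sub>+\<^sub>1 = +\<infinity>\<close> are
  rendered by dropping the corresponding bound.
\<close>

definition cell :: "nat \<Rightarrow> (nat \<Rightarrow> real) \<Rightarrow> nat \<Rightarrow> real set" where
  "cell N x j = {t. (1 \<le> j \<longrightarrow> x j < t) \<and> (j < N \<longrightarrow> t < x (Suc j))}"

text \<open>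
  \<open>u'(x\<^sub>j\<^sup>-)\<close> and \<open>u'(x\<^sub>j\<^sup>+)\<close> are the one-sided limits of the derivative of \<open>u\<close>.
\<close>

definition delta_matching :: "real \<Rightarrow> real \<Rightarrow> real \<Rightarrow> real \<Rightarrow> (real \<Rightarrow> complex) \<Rightarrow> bool" where
  "delta_matching h c b a u \<longleftrightarrow>
     (u \<longlongrightarrow> u a) (at_left a) \<and> (u \<longlongrightarrow> u a) (at_right a) \<and>
     (\<exists>dl dr. ((\<lambda>t. vector_derivative u (at t)) \<longlongrightarrow> dl) (at_left a) \<and>
              ((\<lambda>t. vector_derivative u (at t)) \<longlongrightarrow> dr) (at_right a) \<and>
              of_real (h\<^sup>2) * (dl - dr) + of_real (c * h powr (1 + b)) * u a = 0)"

definition is_resonance ::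
  "nat \<Rightarrow> (nat \<Rightarrow> real) \<Rightarrow> (nat \<Rightarrow> real) \<Rightarrow> (nat \<Rightarrow> real) \<Rightarrow> real \<Rightarrow> complex \<Rightarrow> bool" where
  "is_resonance N x C \<beta> h z \<longleftrightarrow>
     z \<noteq> 0 \<and>
     (\<exists>vp vm :: nat \<Rightarrow> complex. \<exists>u :: real \<Rightarrow> complex.
        (\<exists>j\<in>{0..N}. vp j \<noteq> 0 \<or> vm j \<noteq> 0) \<and>
        vp 0 = 0 \<and> vm N = 0 \<and>
        (\<forall>j\<in>{0..N}. \<forall>t\<in>cell N x j.
           u t = vp j * exp (\<i> * z * of_real t / of_real h)
               + vm j * exp (- \<i> * z * of_real t / of_real h)) \<and>
        (\<forall>j\<in>{1..N}. delta_matching h (C j) (\<beta> j) (x j) u))"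

definition newton_points :: "nat \<Rightarrow> (nat \<Rightarrow> real) \<Rightarrow> (nat \<Rightarrow> real) \<Rightarrow> (real \<times> real) set" where
  "newton_points N x \<beta> =
     {(2 * (x k - x j), \<beta> j + \<beta> k) | j k. 1 \<le> j \<and> j < k \<and> k \<le> N} \<union> {(0, 0)}"

definition newton_polygon :: "nat \<Rightarrow> (nat \<Rightarrow> real) \<Rightarrow> (nat \<Rightarrow> real) \<Rightarrow> (real \<times> real) set" where
  "newton_polygon N x \<beta> =
     convex hull {(l, t) | l t. \<exists>\<nu>. (l, \<nu>) \<in> newton_points N x \<beta> \<and> \<nu> \<le> t}"

text \<open>
  An edge is non-vertical iff it contains two points with different first coordinates, and any
  two such points determine its slope.
\<close>

definition newton_slopes :: "nat \<Rightarrow> (nat \<Rightarrow> real) \<Rightarrow> (nat \<Rightarrow> real) \<Rightarrow> real set" where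
  "newton_slopes N x \<beta> =
     {(snd q - snd p) / (fst q - fst p) | e p q.
        e edge_of newton_polygon N x \<beta> \<and> p \<in> e \<and> q \<in> e \<and> fst p \<noteq> fst q}"

definition unique_slopes :: "nat \<Rightarrow> (nat \<Rightarrow> real) \<Rightarrow> (nat \<Rightarrow> real) \<Rightarrow> bool" where
  "unique_slopes N x \<beta> \<longleftrightarrow>
     (\<forall>p\<in>newton_points N x \<beta>. \<forall>q\<in>newton_points N x \<beta>. \<forall>r\<in>newton_points N x \<beta>.
        p \<noteq> q \<and> q \<noteq> r \<and> p \<noteq> r \<and> collinear {p, q, r} \<longrightarrow>
        (\<exists>s\<in>{p, q, r}. s \<in> interior (newton_polygon N x \<beta>)))"

end

theory Submission
  imports Defs
begin

text \<open>
  The determinant of the resonance problem is a finite sum of terms comparable to powers of \<open>h\<close>, and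
  a resonance forces its leading terms to cancel; two terms can share the leading exponent only along
  an edge of the Newton polygon.

  In more detail, write \<open>a\<^sub>j = C\<^sub>j h\<^bsup>\<beta>\<^sub>j\<^esup> / (2\<i>z)\<close> and \<open>q\<^sub>j = exp (2\<i>z x\<^sub>j / h)\<close>. The matching condition at
  \<open>x\<^sub>j\<close> determines the two coefficients on its right from those on its left
  (\<open>delta_matching_transfer\<close>). The solution with \<open>v\<^sub>0\<^sup>+ = 0\<close>, \<open>v\<^sub>0\<^sup>- = 1\<close> is thus computed recursively, and
  \<open>z\<close> can be a resonance only if its last incoming coefficient \<open>v\<^sub>N\<^sup>-\<close> vanishes
  (\<open>resonance_imp_left_amp_eq_0\<close>).

  If \<open>Im z = - \<gamma> h log (1/h) + O(h)\<close>, then \<open>a\<^sub>j\<close> has exact order \<open>h\<^bsup>\<beta>\<^sub>j\<^esup>\<close> and \<open>q\<^sub>l / q\<^sub>k\<close> has exact order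
  \<open>h\<^bsup>-2\<gamma>(x\<^sub>l - x\<^sub>k)\<^esup>\<close>. Expanding \<open>v\<^sub>N\<^sup>-\<close> gives \<open>1\<close>, the terms \<open>- a\<^sub>k a\<^sub>l q\<^sub>l / q\<^sub>k\<close> for \<open>k < l\<close>, and products
  with more factors. The term of \<open>k < l\<close> has exponent \<open>f k l = \<beta>\<^sub>k + \<beta>\<^sub>l - 2\<gamma>(x\<^sub>l - x\<^sub>k)\<close>, which is
  \<open>\<nu> - \<gamma>\<lambda>\<close> at the corresponding point \<open>(\<lambda>, \<nu>)\<close> of the Newton polygon, while \<open>1\<close> belongs to
  \<open>(0, 0)\<close>. Terms with more factors are negligible: an inner scatterer costs an extra \<open>\<beta>\<close>, and two
  disjoint intervals \<open>k < i < j < l\<close> are beaten by the interval that spans them, as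
  \<open>f k i + f j l = f k l + \<beta>\<^sub>i + \<beta>\<^sub>j + 2\<gamma>(x\<^sub>j - x\<^sub>i)\<close>. This is \<open>transfer_expansion\<close>.

  Hence \<open>v\<^sub>N\<^sup>- = 0\<close> is impossible for small \<open>h\<close> if the minimum \<open>m\<close> of \<open>\<nu> - \<gamma>\<lambda>\<close> is attained by a single
  term (\<open>lone_leading_term_contradiction\<close>). If it is attained at two points with different \<open>\<lambda>\<close>, the line
  \<open>\<nu> = \<gamma>\<lambda> + m\<close> supports the polygon along an edge, and \<open>\<gamma>\<close> is its slope
  (\<open>common_support_line_imp_slope\<close>). The remaining possibility, two index pairs that give the same
  point, leads back to the previous one or to a smaller value by exchanging the right ends of the two
  intervals (\<open>unique_minimal_pair\<close>).

  For \<open>\<gamma> \<le> 0\<close> all \<open>f k l\<close> are positive and \<open>1\<close> dominates. Both signs are treated at once by using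
  \<open>g = 2 max \<gamma> 0\<close> for \<open>2\<gamma>\<close> in the upper bounds.
\<close>

section \<open>From resonances to a transfer recursion\<close>

text \<open>
  For one-sided filters: an identity that holds on one side of \<open>t\<^sub>0\<close> holds near each nearby point
  of that side, and so may be differentiated there.
\<close>

lemma eventually_at_within_open_nhds:
  fixes t0 :: "'a :: t1_space"
  assumes "eventually P (at t0 within S)" "open S"
  shows "eventually (\<lambda>t. eventually P (nhds t)) (at t0 within S)"
proof -
  obtain T where T: "open T" "t0 \<in> T" "\<forall>t\<in>T. t \<noteq> t0 \<longrightarrow> t \<in> S \<longrightarrow> P t"
    using assms(1) unfolding eventually_at_topological by auto
  have "eventually P (nhds t)" if "t \<in> T" "t \<noteq> t0" "t \<in> S" for t
    unfolding eventually_nhds using T that assms(2)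
    by (intro exI[of _ "T \<inter> S - {t0}"]) auto
  with T(1,2) show ?thesis unfolding eventually_at_topological by auto
qed

definition plane_wave :: "complex \<Rightarrow> complex \<Rightarrow> complex \<Rightarrow> real \<Rightarrow> complex" where
  "plane_wave \<kappa> p m t = p * exp (\<i> * \<kappa> * of_real t) + m * exp (- (\<i> * \<kappa> * of_real t))"

lemma vector_derivative_plane_wave:
  "vector_derivative (plane_wave \<kappa> p m) (at t) = \<i> * \<kappa> * plane_wave \<kappa> p (- m) t"
proof (rule vector_derivative_at)
  have "((\<lambda>w. p * exp (\<i> * \<kappa> * w) + m * exp (- (\<i> * \<kappa> * w))) has_field_derivative
      \<i> * \<kappa> * plane_wave \<kappa> p (- m) t) (at (of_real t))"
    by (auto intro!: derivative_eq_intros simp: plane_wave_def algebra_simps)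
  from has_vector_derivative_real_field[OF this]
  show "(plane_wave \<kappa> p m has_vector_derivative \<i> * \<kappa> * plane_wave \<kappa> p (- m) t) (at t)"
    by (simp add: plane_wave_def[abs_def])
qed

lemma plane_wave_tendsto: "(plane_wave \<kappa> p m \<longlongrightarrow> plane_wave \<kappa> p m t) (at t within S)"
  unfolding plane_wave_def[abs_def] by (intro tendsto_intros)

lemma one_sided_limits_plane_wave:
  assumes "eventually (\<lambda>t. u t = plane_wave \<kappa> p m t) (at t0 within S)" "open S"
    and "at t0 within S \<noteq> bot"
    and "(u \<longlongrightarrow> u0) (at t0 within S)"
    and "((\<lambda>t. vector_derivative u (at t)) \<longlongrightarrow> d) (at t0 within S)"
  shows "u0 = plane_wave \<kappa> p m t0" "d = \<i> * \<kappa> * plane_wave \<kappa> p (- m) t0"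
proof -
  have "(plane_wave \<kappa> p m \<longlongrightarrow> u0) (at t0 within S)"
    using assms(4,1) by (rule Lim_transform_eventually)
  then show "u0 = plane_wave \<kappa> p m t0"
    using tendsto_unique[OF assms(3) _ plane_wave_tendsto] by simp
  have "eventually (\<lambda>t. vector_derivative u (at t) = \<i> * \<kappa> * plane_wave \<kappa> p (- m) t)
          (at t0 within S)"
    using eventually_at_within_open_nhds[OF assms(1,2)]
  proof eventually_elim
    case (elim t)
    then have "vector_derivative u (at t) = vector_derivative (plane_wave \<kappa> p m) (at t)"
      by (intro vector_derivative_cong_eq) auto
    then show ?case by (simp add: vector_derivative_plane_wave)
  qed
  then have "((\<lambda>t. \<i> * \<kappa> * plane_wave \<kappa> p (- m) t) \<longlongrightarrow> d) (at t0 within S)"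
    by (rule Lim_transform_eventually[OF assms(5)])
  moreover have "((\<lambda>t. \<i> * \<kappa> * plane_wave \<kappa> p (- m) t) \<longlongrightarrow> \<i> * \<kappa> * plane_wave \<kappa> p (- m) t0)
      (at t0 within S)"
    by (intro tendsto_intros plane_wave_tendsto)
  ultimately show "d = \<i> * \<kappa> * plane_wave \<kappa> p (- m) t0"
    by (rule tendsto_unique[OF assms(3)])
qed

text \<open>
  Continuity makes the jumps of the two coefficients, weighted by \<open>e\<close> and \<open>1/e\<close> with
  \<open>e = exp (\<i>z t\<^sub>0 / h)\<close>, opposite to each other, so both contribute equally to the jump of the
  derivative; each is therefore half of what the matching condition prescribes, namely \<open>a\<close> times
  the value of \<open>u\<close> at \<open>t\<^sub>0\<close>.
\<close>

lemma delta_matching_transfer: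
  assumes h: "h > 0" and z: "z \<noteq> 0"
    and u: "delta_matching h c b t0 u"
    and l: "eventually (\<lambda>t. u t = plane_wave (z / of_real h) p m t) (at_left t0)"
    and r: "eventually (\<lambda>t. u t = plane_wave (z / of_real h) p' m' t) (at_right t0)"
  defines "a \<equiv> of_real (c * h powr b) / (2 * \<i> * z)"
    and "q \<equiv> exp (2 * \<i> * z * of_real t0 / of_real h)"
  shows "p' = (1 + a) * p + a / q * m" "m' = (1 - a) * m - a * q * p"
proof -
  define \<kappa> where "\<kappa> = z / of_real h"
  define e where "e = exp (\<i> * \<kappa> * of_real t0)"
  have e: "e \<noteq> 0" "q = e\<^sup>2" "exp (- (\<i> * \<kappa> * of_real t0)) = inverse e"
    by (auto simp: e_def q_def \<kappa>_def exp_minus power2_eq_square mult_ac simp flip: exp_add)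
  note w = plane_wave_def e(3) e_def[symmetric]
  obtain dl dr where lim: "(u \<longlongrightarrow> u t0) (at_left t0)" "(u \<longlongrightarrow> u t0) (at_right t0)"
     "((\<lambda>t. vector_derivative u (at t)) \<longlongrightarrow> dl) (at_left t0)"
     "((\<lambda>t. vector_derivative u (at t)) \<longlongrightarrow> dr) (at_right t0)"
    and jump: "of_real (h\<^sup>2) * (dl - dr) + of_real (c * h powr (1 + b)) * u t0 = 0"
    using u unfolding delta_matching_def by blast
  note left = one_sided_limits_plane_wave[OF l open_lessThan trivial_limit_at_left_real lim(1,3),
      folded \<kappa>_def]
  note right = one_sided_limits_plane_wave[OF r open_greaterThan trivial_limit_at_right_real lim(2,4),
      folded \<kappa>_def]
  have cont: "(p' - p) * e = (m - m') * inverse e"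
    using left(1) right(1) unfolding w by (simp add: algebra_simps)
  have "dl - dr = \<i> * \<kappa> * ((m' - m) * inverse e - (p' - p) * e)"
    unfolding left(2) right(2) w by (simp add: algebra_simps)
  also have "\<dots> = - 2 * \<i> * \<kappa> * ((p' - p) * e)"
    unfolding cont by (simp add: algebra_simps)
  finally have diff: "dl - dr = - 2 * \<i> * \<kappa> * ((p' - p) * e)" .
  have "of_real (c * h powr (1 + b)) = of_real h * (2 * \<i> * z) * a"
    using h z by (simp add: a_def powr_add)
  moreover have "of_real (h\<^sup>2) * (dl - dr) = - (of_real h * (2 * \<i> * z) * ((p' - p) * e))"
    unfolding diff using h by (simp add: \<kappa>_def power2_eq_square)
  ultimately have "of_real h * (2 * \<i> * z) * (a * u t0) = of_real h * (2 * \<i> * z) * ((p' - p) * e)"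
    using jump by (simp add: mult.assoc)
  then have *: "(p' - p) * e = a * (p * e + m * inverse e)"
    using h z left(1) unfolding w by simp
  have "p' - p = (p' - p) * e * inverse e" using e(1) by simp
  also have "\<dots> = a * p + a / q * m"
    unfolding * using e(1) by (simp add: e(2) power2_eq_square divide_inverse distrib_left distrib_right)
  finally show "p' = (1 + a) * p + a / q * m" by (simp add: algebra_simps)
  have "m - m' = (m - m') * inverse e * e" using e(1) by simp
  also have "\<dots> = a * m + a * q * p"
    unfolding cont[symmetric] * using e(1)
    by (simp add: e(2) power2_eq_square distrib_left distrib_right)
  finally show "m' = (1 - a) * m - a * q * p" by (simp add: algebra_simps)
qed

definition coupling :: "(nat \<Rightarrow> real) \<Rightarrow> (nat \<Rightarrow> real) \<Rightarrow> real \<Rightarrow> complex \<Rightarrow> nat \<Rightarrow> complex" where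
  "coupling C \<beta> h z j = of_real (C j * h powr \<beta> j) / (2 * \<i> * z)"

definition phase :: "(nat \<Rightarrow> real) \<Rightarrow> real \<Rightarrow> complex \<Rightarrow> nat \<Rightarrow> complex" where
  "phase x h z j = exp (2 * \<i> * z * of_real (x j) / of_real h)"

text \<open>
  The coefficients \<open>v\<^sub>j\<^sup>+\<close> and \<open>v\<^sub>j\<^sup>-\<close> of the solution that is \<open>e\<^bsup>-\<i>zx/h\<^esup>\<close> to the left of all scatterers,
  for coupling factors \<open>a\<close> and squared phases \<open>q\<close>.
\<close>

fun right_amp left_amp :: "(nat \<Rightarrow> complex) \<Rightarrow> (nat \<Rightarrow> complex) \<Rightarrow> nat \<Rightarrow> complex" where
  "right_amp a q 0 = 0"
| "right_amp a q (Suc j) =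
     (1 + a (Suc j)) * right_amp a q j + a (Suc j) / q (Suc j) * left_amp a q j"
| "left_amp a q 0 = 1"
| "left_amp a q (Suc j) =
     (1 - a (Suc j)) * left_amp a q j - a (Suc j) * q (Suc j) * right_amp a q j"

text \<open>
  By linearity a solution with \<open>v\<^sub>0\<^sup>+ = 0\<close> is \<open>v\<^sub>0\<^sup>-\<close> times the recursively computed one. If it is nonzero,
  then so is \<open>v\<^sub>0\<^sup>-\<close>, and the condition \<open>v\<^sub>N\<^sup>- = 0\<close> becomes one on the recursion alone.
\<close>

lemma resonance_imp_left_amp_eq_0:
  assumes h: "h > 0" and x: "strict_mono_on {1..N} x" and res: "is_resonance N x C \<beta> h z"
  shows "left_amp (coupling C \<beta> h z) (phase x h z) N = 0"
proof -
  define R where "R = right_amp (coupling C \<beta> h z) (phase x h z)"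
  define L where "L = left_amp (coupling C \<beta> h z) (phase x h z)"
  obtain vp vm u where z: "z \<noteq> 0"
    and nz: "\<exists>j\<in>{0..N}. vp j \<noteq> 0 \<or> vm j \<noteq> 0"
    and ends: "vp 0 = 0" "vm N = 0"
    and cells: "\<forall>j\<in>{0..N}. \<forall>t\<in>cell N x j.
           u t = vp j * exp (\<i> * z * of_real t / of_real h)
               + vm j * exp (- \<i> * z * of_real t / of_real h)"
    and match: "\<forall>j\<in>{1..N}. delta_matching h (C j) (\<beta> j) (x j) u"
    using res unfolding is_resonance_def by (elim conjE exE) (rule that)
  have wave: "u t = plane_wave (z / of_real h) (vp j) (vm j) t" if "j \<in> {0..N}" "t \<in> cell N x j" for j t
    using bspec[OF bspec[OF cells that(1)] that(2)] by (simp add: plane_wave_def)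
  have step: "vp (Suc j) = (1 + coupling C \<beta> h z (Suc j)) * vp j
                + coupling C \<beta> h z (Suc j) / phase x h z (Suc j) * vm j \<and>
              vm (Suc j) = (1 - coupling C \<beta> h z (Suc j)) * vm j
                - coupling C \<beta> h z (Suc j) * phase x h z (Suc j) * vp j" if j: "Suc j \<le> N" for j
  proof -
    have xless: "x i < x (Suc i)" if "1 \<le> i" "Suc i \<le> N" for i
      using strict_mono_onD[OF x, of i "Suc i"] that by auto
    have "\<exists>b < x (Suc j). \<forall>t>b. t < x (Suc j) \<longrightarrow> t \<in> cell N x j"
      by (rule exI[of _ "if j = 0 then x (Suc j) - 1 else x j"]) (use xless[of j] j in \<open>auto simp: cell_def\<close>)
    then have l: "eventually (\<lambda>t. u t = plane_wave (z / of_real h) (vp j) (vm j) t) (at_left (x (Suc j)))"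
      unfolding eventually_at_left_field using wave[of j] j by auto
    have "\<exists>b > x (Suc j). \<forall>t>x (Suc j). t < b \<longrightarrow> t \<in> cell N x (Suc j)"
      by (rule exI[of _ "if Suc j = N then x (Suc j) + 1 else x (Suc (Suc j))"])
         (use xless[of "Suc j"] j in \<open>auto simp: cell_def\<close>)
    then have r: "eventually (\<lambda>t. u t = plane_wave (z / of_real h) (vp (Suc j)) (vm (Suc j)) t)
        (at_right (x (Suc j)))"
      unfolding eventually_at_right_field using wave[of "Suc j"] j by auto
    show ?thesis
      using delta_matching_transfer[OF h z bspec[OF match] l r] j by (simp add: coupling_def phase_def)
  qed
  have amp: "j \<le> N \<Longrightarrow> vp j = R j * vm 0 \<and> vm j = L j * vm 0" for j
  proof (induction j)
    case 0
    show ?case using ends by (simp add: R_def L_def)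
  next
    case (Suc j)
    then show ?case using step[of j] by (simp add: R_def L_def algebra_simps)
  qed
  obtain i where "i \<le> N" "vp i \<noteq> 0 \<or> vm i \<noteq> 0" using nz by auto
  then have "vm 0 \<noteq> 0" using amp[of i] by auto
  then show ?thesis using amp[of N] ends by (simp add: L_def)
qed

section \<open>Minimal points and slopes of the Newton polygon\<close>

text \<open>
  The line \<open>\<nu> = \<gamma>\<lambda> + m\<close> lies below all points, hence below the convex hull of their epigraph, and it
  meets that hull in a face. This face is contained in a line and contains two points.
\<close>

lemma common_support_line_imp_slope:
  assumes "P \<in> newton_points N x \<beta>" "Q \<in> newton_points N x \<beta>" "fst P \<noteq> fst Q"
    and P: "snd P - \<gamma> * fst P = m" and Q: "snd Q - \<gamma> * fst Q = m"
    and min: "\<And>R. R \<in> newton_points N x \<beta> \<Longrightarrow> m \<le> snd R - \<gamma> * fst R"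
  shows "\<gamma> \<in> newton_slopes N x \<beta>"
proof -
  define K where "K = newton_polygon N x \<beta>"
  define v :: "real \<times> real" where "v = (- \<gamma>, 1)"
  define e where "e = K \<inter> {y. v \<bullet> y = m}"
  have inner: "v \<bullet> y = snd y - \<gamma> * fst y" for y
    by (cases y) (simp add: v_def)
  have K: "R \<in> K" if "R \<in> newton_points N x \<beta>" for R
    unfolding K_def newton_polygon_def using that by (cases R) (auto intro!: hull_inc)
  have "K \<subseteq> {y. v \<bullet> y \<ge> m}"
    unfolding K_def newton_polygon_def
  proof (rule hull_minimal)
    show "convex {y. v \<bullet> y \<ge> m}" by (rule convex_halfspace_ge)
    show "{(l, t) | l t. \<exists>\<nu>. (l, \<nu>) \<in> newton_points N x \<beta> \<and> \<nu> \<le> t} \<subseteq> {y. v \<bullet> y \<ge> m}"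
      using min by (force simp: inner)
  qed
  then have face: "e face_of K"
    unfolding e_def
    by (intro face_of_Int_supporting_hyperplane_ge)
       (auto simp: K_def newton_polygon_def convex_convex_hull)
  have Pe: "P \<in> e" and Qe: "Q \<in> e" using assms K by (auto simp: e_def inner)
  have "v \<noteq> 0" by (simp add: v_def zero_prod_def)
  have "aff_dim e \<le> aff_dim {y. v \<bullet> y = m}" by (intro aff_dim_subset) (simp add: e_def)
  also have "\<dots> = 1" using \<open>v \<noteq> 0\<close> by (simp add: aff_dim_hyperplane)
  finally have "aff_dim e \<le> 1" .
  moreover have "aff_dim {P, Q} \<le> aff_dim e" using Pe Qe by (intro aff_dim_subset) auto
  moreover have "aff_dim {P, Q} = 1" using assms(3) by auto
  ultimately have "e edge_of K" using face by (simp add: edge_of_def)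
  moreover have "\<gamma> = (snd Q - snd P) / (fst Q - fst P)"
    using P Q assms(3) by (simp add: field_simps)
  ultimately show ?thesis
    unfolding newton_slopes_def K_def[symmetric] using Pe Qe assms(3) by blast
qed

text \<open>
  Different index pairs may have the same point \<open>(\<lambda>, \<nu>)\<close>, and their terms could then cancel. At a
  minimum this does not happen: two intervals \<open>[x\<^sub>k, x\<^sub>l]\<close> and \<open>[x\<^sub>k', x\<^sub>l']\<close> of equal length with
  \<open>k < k'\<close> yield the longer interval \<open>[x\<^sub>k, x\<^sub>l']\<close>, whose value is minimal as well if the two
  overlap, which makes \<open>\<gamma>\<close> a slope, and smaller than \<open>m\<close> otherwise.
\<close>

lemma unique_minimal_pair:
  fixes x \<beta> :: "nat \<Rightarrow> real" and \<gamma> m :: real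
  defines "f \<equiv> \<lambda>k l. \<beta> k + \<beta> l - 2 * \<gamma> * (x l - x k)"
  assumes x: "strict_mono_on {1..N} x"
    and \<beta>: "\<And>j. j \<in> {1..N} \<Longrightarrow> \<beta> j > 0"
    and "\<gamma> \<ge> 0"
    and not_slope: "\<gamma> \<notin> newton_slopes N x \<beta>"
    and "m \<le> 0"
    and min: "\<And>k l. 1 \<le> k \<Longrightarrow> k < l \<Longrightarrow> l \<le> N \<Longrightarrow> m \<le> f k l"
    and p: "1 \<le> k" "k < l" "l \<le> N" "f k l = m"
    and p': "1 \<le> k'" "k' < l'" "l' \<le> N" "f k' l' = m"
  shows "k' = k \<and> l' = l"
proof -
  have newton: "(2 * (x l - x k), \<beta> k + \<beta> l) \<in> newton_points N x \<beta>"
    if "1 \<le> k" "k < l" "l \<le> N" for k l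
    using that by (auto simp: newton_points_def)
  have min': "m \<le> snd R - \<gamma> * fst R" if "R \<in> newton_points N x \<beta>" for R
    using that min \<open>m \<le> 0\<close> by (auto simp: newton_points_def f_def algebra_simps)
  have same: "x l - x k = x l' - x k'"
    if "1 \<le> k" "k < l" "l \<le> N" "f k l = m" "1 \<le> k'" "k' < l'" "l' \<le> N" "f k' l' = m" for k l k' l'
  proof (rule ccontr)
    assume "x l - x k \<noteq> x l' - x k'"
    then have "\<gamma> \<in> newton_slopes N x \<beta>"
      by (intro common_support_line_imp_slope[OF newton[of k l] newton[of k' l'] _ _ _ min'])
         (use that in \<open>auto simp: f_def algebra_simps\<close>)
    then show False using not_slope by simp
  qed
  have xless: "x i < x j" if "1 \<le> i" "i < j" "j \<le> N" for i j
    using strict_mono_onD[OF x] that by auto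
  have xless_iff: "x i < x j \<longleftrightarrow> i < j" if "i \<in> {1..N}" "j \<in> {1..N}" for i j
    using strict_mono_on_less[OF x that] .
  have no: False if p: "1 \<le> k" "k < l" "l \<le> N" "f k l = m"
    and p': "1 \<le> k'" "k' < l'" "l' \<le> N" "f k' l' = m" and "k < k'" for k l k' l'
  proof -
    have d: "x l - x k = x l' - x k'" by (rule same[OF p p'])
    have "x k < x k'" using xless[of k k'] p p' \<open>k < k'\<close> by simp
    then have "x l < x l'" using d by simp
    then have "l < l'" using xless_iff[of l l'] p p' by simp
    have outer: "m \<le> f k l'" using min[of k l'] p(1,2) p'(3) \<open>l < l'\<close> by simp
    show False
    proof (cases "k' < l")
      case True
      \<comment> \<open>Exchanging the right ends preserves the sum, so both new pairs are minimal, but their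
        lengths differ from that of the old ones.\<close>
      have "m \<le> f k' l" using min[of k' l] p(3) p'(1) True by simp
      moreover have "f k l' + f k' l = f k l + f k' l'" by (simp add: f_def algebra_simps)
      ultimately have "f k l' = m" using outer p p' by linarith
      moreover have "k < l'" using \<open>k < l\<close> \<open>l < l'\<close> by simp
      ultimately have "x l - x k = x l' - x k" using same[OF p, of k l'] p(1) p'(3) by simp
      with \<open>x l < x l'\<close> show False by simp
    next
      case False
      \<comment> \<open>The spanning interval beats the sum of the two, and \<open>m + m \<le> m\<close>.\<close>
      have "x l \<le> x k'" using xless_iff[of k' l] False p p' by (simp add: not_less[symmetric])
      then have "0 \<le> 2 * \<gamma> * (x k' - x l)" using \<open>\<gamma> \<ge> 0\<close> by (intro mult_nonneg_nonneg) auto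
      moreover have "f k l' + \<beta> l + \<beta> k' + 2 * \<gamma> * (x k' - x l) = f k l + f k' l'"
        by (simp add: f_def algebra_simps)
      moreover have "\<beta> l > 0" "\<beta> k' > 0" using p p' by (auto intro!: \<beta>)
      ultimately show False using outer p(4) p'(4) \<open>m \<le> 0\<close> by linarith
    qed
  qed
  have "k' = k" using no[OF p p'] no[OF p' p] by (meson linorder_neqE_nat)
  moreover have "x l = x l'" using same[OF p p'] \<open>k' = k\<close> by simp
  then have "l' = l" 
    using xless_iff[of l l'] xless_iff[of l' l] p p'
    by (metis atLeastAtMost_iff less_irrefl linorder_neqE_nat le_trans less_imp_le)
  ultimately show ?thesis by simp
qed

section \<open>Orders of magnitude in powers of a vanishing parameter\<close>

locale vanishing_scale =
  fixes h :: "nat \<Rightarrow> real"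
  assumes h_pos: "h n > 0" and h_lim: "h \<longlonglongrightarrow> 0"
begin

text \<open>
  Powers of \<open>h\<close> with complex values, so that they can be compared with complex sequences in
  Landau notation.
\<close>

definition scale :: "real \<Rightarrow> nat \<Rightarrow> complex" where
  "scale s n = of_real (h n powr s)"

lemma scale_nonzero: "scale s n \<noteq> 0"
  using h_pos[of n] by (simp add: scale_def)

lemma norm_scale: "norm (scale s n) = h n powr s"
  by (simp add: scale_def)

lemma scale_add: "scale (s + t) n = scale s n * scale t n"
  using h_pos[of n] by (simp add: scale_def powr_add)

lemma scale_tendsto_0:
  assumes "s > 0" shows "(scale s \<longlongrightarrow> 0) sequentially"
proof -
  have "((\<lambda>n. h n powr s) \<longlongrightarrow> 0 powr s) sequentially"
    using assms h_pos by (intro tendsto_powr' h_lim tendsto_const) (auto simp: less_imp_le)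
  then have "((\<lambda>n. complex_of_real (h n powr s)) \<longlongrightarrow> of_real 0) sequentially"
    using assms by (intro tendsto_of_real) simp
  then show ?thesis by (simp add: scale_def[abs_def])
qed

lemma scale_smallo: assumes "s > t" shows "scale s \<in> o(scale t)"
proof (rule smalloI_tendsto)
  have "(\<lambda>n. scale s n / scale t n) = scale (s - t)"
    using scale_add[of "s - t" t] scale_nonzero[of t] by (auto simp: fun_eq_iff)
  then show "((\<lambda>n. scale s n / scale t n) \<longlongrightarrow> 0) sequentially"
    using scale_tendsto_0[of "s - t"] assms by simp
qed (simp add: scale_nonzero)

lemma bigo_scale_mono:
  assumes "f \<in> O(scale s)" "t \<le> s" shows "f \<in> O(scale t)"
proof (cases "s = t")
  case False
  then show ?thesis
    using assms scale_smallo[of t s] landau_o.small_imp_big landau_o.big_trans by force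
qed (use assms in simp)

lemma bigo_scale_mult:
  assumes "f \<in> O(scale s)" "g \<in> O(scale t)" "u \<le> s + t"
  shows "(\<lambda>n. f n * g n) \<in> O(scale u)"
proof (rule bigo_scale_mono)
  show "(\<lambda>n. f n * g n) \<in> O(scale (s + t))"
    using landau_o.big.mult[OF assms(1,2)] by (simp add: scale_add[abs_def] scale_add)
qed (rule assms)

lemma bigo_scale_smallo:
  assumes "f \<in> O(scale s)" "t < s" shows "f \<in> o(scale t)"
  using assms scale_smallo landau_o.big_small_trans by blast

lemma const_bigo_scale: assumes "s \<le> 0" shows "(\<lambda>_. c) \<in> O(scale s)"
proof (rule bigo_scale_mono)
  have "scale 0 = (\<lambda>_. 1)" using h_pos by (auto simp: scale_def fun_eq_iff less_imp_neq[symmetric])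
  then show "(\<lambda>_. c) \<in> O(scale 0)" by simp
qed (rule assms)

end

section \<open>Leading terms of the transfer recursion\<close>

text \<open>
  The leading part of \<open>right_amp\<close>: the left-moving wave, reflected once at one of the scatterers.
\<close>

definition single_sum :: "(nat \<Rightarrow> complex) \<Rightarrow> (nat \<Rightarrow> complex) \<Rightarrow> nat \<Rightarrow> complex" where
  "single_sum a q j = (\<Sum>k\<in>{1..j}. a k / q k)"

text \<open>
  The contribution to \<open>left_amp\<close>, up to sign, of a wave that is reflected once at each of two
  scatterers.
\<close>

definition round_trip :: "(nat \<Rightarrow> complex) \<Rightarrow> (nat \<Rightarrow> complex) \<Rightarrow> nat \<times> nat \<Rightarrow> complex" where
  "round_trip a q = (\<lambda>(k, l). a k * a l * (q l / q k))"

definition index_pairs :: "nat \<Rightarrow> (nat \<times> nat) set" where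
  "index_pairs j = {(k, l). 1 \<le> k \<and> k < l \<and> l \<le> j}"

lemma index_pairs_0: "index_pairs 0 = {}" by (auto simp: index_pairs_def)

lemma index_pairs_Suc: "index_pairs (Suc j) = index_pairs j \<union> (\<lambda>k. (k, Suc j)) ` {1..j}"
  by (auto simp: index_pairs_def)

lemma finite_index_pairs: "finite (index_pairs j)"
  by (induction j) (auto simp: index_pairs_0 index_pairs_Suc)

lemma sum_round_trip_Suc:
  "sum (round_trip a q) (index_pairs (Suc j)) =
     sum (round_trip a q) (index_pairs j) + a (Suc j) * (q (Suc j) * single_sum a q j)"
proof -
  have "sum (round_trip a q) (index_pairs (Suc j)) =
        sum (round_trip a q) (index_pairs j) + sum (round_trip a q) ((\<lambda>k. (k, Suc j)) ` {1..j})"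
    unfolding index_pairs_Suc
    by (rule sum.union_disjoint) (auto simp: finite_index_pairs, auto simp: index_pairs_def)
  also have "sum (round_trip a q) ((\<lambda>k. (k, Suc j)) ` {1..j}) = (\<Sum>k\<in>{1..j}. round_trip a q (k, Suc j))"
    by (subst sum.reindex) (auto simp: inj_on_def)
  also have "\<dots> = a (Suc j) * (q (Suc j) * single_sum a q j)"
    by (simp add: round_trip_def single_sum_def sum_distrib_left mult_ac)
  finally show ?thesis .
qed

context vanishing_scale
begin

context
  fixes N :: nat and x \<beta> :: "nat \<Rightarrow> real" and g \<delta> :: real
    and a q :: "nat \<Rightarrow> nat \<Rightarrow> complex"
    and f :: "nat \<Rightarrow> nat \<Rightarrow> real"
  defines "f \<equiv> \<lambda>k l. \<beta> k + \<beta> l - g * (x l - x k)"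
  assumes g: "g \<ge> 0" and \<delta>: "\<delta> > 0"
    and x: "strict_mono_on {1..N} x"
    and \<beta>: "\<And>j. j \<in> {1..N} \<Longrightarrow> \<delta> \<le> \<beta> j"
    and a: "\<And>j. j \<in> {1..N} \<Longrightarrow> (\<lambda>n. a n j) \<in> O(scale (\<beta> j))"
    and q: "\<And>k l. (k, l) \<in> index_pairs N \<Longrightarrow> (\<lambda>n. q n l / q n k) \<in> O(scale (- g * (x l - x k)))"
    and q0: "\<And>n j. q n j \<noteq> 0"
begin

lemma round_trip_bigo:
  assumes "(k, l) \<in> index_pairs N"
  shows "(\<lambda>n. round_trip (a n) (q n) (k, l)) \<in> O(scale (f k l))"
  unfolding round_trip_def prod.case
  by (rule bigo_scale_mult[OF bigo_scale_mult[OF a a order_refl] q])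
     (use assms in \<open>auto simp: f_def index_pairs_def\<close>)

text \<open>
  The reason why pairs dominate: a product over two disjoint intervals is smaller than the term of
  the interval spanning them, by a factor \<open>h\<^bsup>2\<delta>\<^esup>\<close> or better.
\<close>

lemma disjoint_pairs_subadditive:
  assumes "1 \<le> k" "k < i" "i < j" "j < l" "l \<le> N"
  shows "f k l + 2 * \<delta> \<le> f k i + f j l"
proof -
  have "g * (x j - x i) \<ge> 0"
    using g strict_mono_onD[OF x, of i j] assms by (intro mult_nonneg_nonneg) auto
  with \<beta>[of i] \<beta>[of j] assms show ?thesis by (simp add: f_def algebra_simps)
qed

text \<open>
  Both coefficients have to be controlled together. The remainder of \<open>right_amp\<close> is measured by the
  effect \<open>a\<^sub>l q\<^sub>l right_amp\<close> that it has at a later scatterer \<open>l\<close>; after division by \<open>a\<^sub>l\<close> this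
  explains the weight \<open>q\<^sub>l\<close> and the exponent \<open>- \<beta>\<^sub>l\<close>, and it means that only ratios of phases
  occur, for which upper bounds are known. The exponent \<open>\<mu>\<close> is left free, below the minimum over
  the pairs concerned, because a step for \<open>right_amp\<close> multiplies the error of \<open>left_amp\<close> by
  \<open>a\<^sub>j q\<^sub>l / q\<^sub>j\<close>, which may be large: the induction hypothesis is then applied with an exponent that
  compensates for this, admissible by \<open>disjoint_pairs_subadditive\<close>.
\<close>

lemma transfer_expansion:
  assumes "j \<le> N"
  shows "\<And>\<mu>. \<mu> \<le> 0 \<Longrightarrow> (\<And>k l. (k, l) \<in> index_pairs j \<Longrightarrow> \<mu> \<le> f k l) \<Longrightarrow>
           (\<lambda>n. left_amp (a n) (q n) j - (1 - sum (round_trip (a n) (q n)) (index_pairs j)))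
             \<in> O(scale (\<mu> + \<delta>))"
    and "\<And>l \<mu>. j < l \<Longrightarrow> l \<le> N \<Longrightarrow> (\<And>k. k \<in> {1..j} \<Longrightarrow> \<mu> \<le> f k l) \<Longrightarrow>
           (\<lambda>n. q n l * (right_amp (a n) (q n) j - single_sum (a n) (q n) j))
             \<in> O(scale (\<mu> + \<delta> - \<beta> l))"
  using assms
proof (induction j)
  case 0
  {
    case 1 show ?case by (simp add: index_pairs_0)
  next
    case 2 show ?case by (simp add: single_sum_def)
  }
next
  case (Suc j)
  define i where "i = Suc j"
  define L where "L n = left_amp (a n) (q n) j" for n
  define R where "R n = right_amp (a n) (q n) j" for n
  define S where "S n = single_sum (a n) (q n) j" for n
  define T where "T n = sum (round_trip (a n) (q n)) (index_pairs j)" for n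
  define \<rho> where "\<rho> n = L n - (1 - T n)" for n
  have i: "i \<in> {1..N}" if "Suc j \<le> N" using that by (simp add: i_def)
  have IH_L: "\<rho> \<in> O(scale (\<mu> + \<delta>))"
    if "\<mu> \<le> 0" "\<And>k l. (k, l) \<in> index_pairs j \<Longrightarrow> \<mu> \<le> f k l" "Suc j \<le> N" for \<mu>
    using Suc.IH(1)[of \<mu>] that by (simp add: \<rho>_def[abs_def] L_def T_def)
  have IH_R: "(\<lambda>n. q n l * (R n - S n)) \<in> O(scale (\<mu> + \<delta> - \<beta> l))"
    if "j < l" "l \<le> N" "\<And>k. k \<in> {1..j} \<Longrightarrow> \<mu> \<le> f k l" for l \<mu>
    using Suc.IH(2)[of l \<mu>] that by (simp add: R_def S_def)
  have T_bigo: "T \<in> O(scale \<mu>)"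
    if "\<And>k l. (k, l) \<in> index_pairs j \<Longrightarrow> \<mu> \<le> f k l" "Suc j \<le> N" for \<mu>
    unfolding T_def[abs_def]
  proof (rule big_sum_in_bigo)
    fix p assume "p \<in> index_pairs j"
    then show "(\<lambda>n. round_trip (a n) (q n) p) \<in> O(scale \<mu>)"
      using that by (cases p) (auto intro!: bigo_scale_mono[OF round_trip_bigo] simp: index_pairs_def)
  qed
  have L_minus_1: "(\<lambda>n. L n - 1) \<in> O(scale \<mu>)"
    if "\<mu> \<le> \<delta>" "\<And>k l. (k, l) \<in> index_pairs j \<Longrightarrow> \<mu> \<le> f k l" "Suc j \<le> N" for \<mu>
  proof -
    have "\<rho> \<in> O(scale (\<mu> - \<delta> + \<delta>))"
      by (rule IH_L) (use that \<delta> in \<open>force simp: algebra_simps\<close>)+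
    then have "(\<lambda>n. \<rho> n - T n) \<in> O(scale \<mu>)"
      using T_bigo[of \<mu>] that by (intro sum_in_bigo) auto
    then show ?thesis by (simp add: \<rho>_def algebra_simps)
  qed
  {
    case (1 \<mu>)
    have \<mu>: "\<mu> \<le> f k l" if "(k, l) \<in> index_pairs j" for k l
      using 1(2)[of k l] that by (auto simp: index_pairs_def)
    have "(\<lambda>n. L n) \<in> O(scale \<mu>)"
      using sum_in_bigo(1)[OF L_minus_1[of \<mu>] const_bigo_scale[of \<mu> 1]] 1 \<mu> \<delta> by auto
    from bigo_scale_mult[OF a this, of i "\<mu> + \<delta>"]
    have aL: "(\<lambda>n. a n i * L n) \<in> O(scale (\<mu> + \<delta>))"
      using i \<beta>[of i] 1 by auto
    have "(\<lambda>n. q n i * (R n - S n)) \<in> O(scale (\<mu> + \<delta> - \<beta> i))"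
      by (rule IH_R) (use 1 in \<open>auto simp: i_def index_pairs_def\<close>)
    from bigo_scale_mult[OF a this, of i "\<mu> + \<delta>"]
    have aR: "(\<lambda>n. a n i * (q n i * (R n - S n))) \<in> O(scale (\<mu> + \<delta>))"
      using i 1 by auto
    have "(\<lambda>n. \<rho> n - a n i * L n - a n i * (q n i * (R n - S n))) \<in> O(scale (\<mu> + \<delta>))"
      using IH_L[of \<mu>] \<mu> 1 aL aR by (intro sum_in_bigo) auto
    then show ?case
      by (simp add: sum_round_trip_Suc \<rho>_def L_def R_def S_def T_def i_def algebra_simps)
  next
    case (2 l \<mu>)
    have "Suc j \<le> N" using 2 by simp
    note i = i[OF this]
    have il: "(i, l) \<in> index_pairs N" using 2 by (auto simp: i_def index_pairs_def)
    have rem: "(\<lambda>n. q n l * (R n - S n)) \<in> O(scale (\<mu> + \<delta> - \<beta> l))"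
      by (rule IH_R) (use 2 in auto)
    have arem: "(\<lambda>n. a n i * (q n l * (R n - S n))) \<in> O(scale (\<mu> + \<delta> - \<beta> l))"
      by (rule bigo_scale_mult[OF a rem]) (use i \<beta>[of i] \<delta> in auto)
    have "(\<lambda>n. \<Sum>k\<in>{1..j}. a n k * (q n l / q n k)) \<in> O(scale (\<mu> - \<beta> l))"
    proof (rule big_sum_in_bigo)
      fix k assume k: "k \<in> {1..j}"
      show "(\<lambda>n. a n k * (q n l / q n k)) \<in> O(scale (\<mu> - \<beta> l))"
      proof (rule bigo_scale_mult[OF a q])
        show "\<mu> - \<beta> l \<le> \<beta> k + - g * (x l - x k)"
          using 2(3)[of k] k by (simp add: f_def)
      qed (use k 2 in \<open>auto simp: index_pairs_def\<close>)
    qed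
    then have "(\<lambda>n. q n l * S n) \<in> O(scale (\<mu> - \<beta> l))"
      by (simp add: S_def single_sum_def sum_distrib_left mult_ac)
    from bigo_scale_mult[OF a this, of i "\<mu> + \<delta> - \<beta> l"]
    have aS: "(\<lambda>n. a n i * (q n l * S n)) \<in> O(scale (\<mu> + \<delta> - \<beta> l))"
      using i \<beta>[of i] by auto
    have "(\<lambda>n. L n - 1) \<in> O(scale (\<mu> + \<delta> - f i l))"
    proof (rule L_minus_1)
      show "\<mu> + \<delta> - f i l \<le> \<delta>" using 2(3)[of i] by (simp add: i_def)
      fix k m assume "(k, m) \<in> index_pairs j"
      then have "f k l + 2 * \<delta> \<le> f k m + f i l" "\<mu> \<le> f k l"
        using 2 by (auto intro!: disjoint_pairs_subadditive simp: index_pairs_def i_def)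
      then show "\<mu> + \<delta> - f i l \<le> f k m" using \<delta> by linarith
    qed (use 2 in auto)
    from bigo_scale_mult[OF bigo_scale_mult[OF a q order_refl] this, of i i l "\<mu> + \<delta> - \<beta> l"]
    have aL: "(\<lambda>n. a n i * (q n l / q n i) * (L n - 1)) \<in> O(scale (\<mu> + \<delta> - \<beta> l))"
      using i il by (auto simp: f_def)
    have "(\<lambda>n. q n l * (R n - S n) + a n i * (q n l * (R n - S n)) + a n i * (q n l * S n)
             + a n i * (q n l / q n i) * (L n - 1)) \<in> O(scale (\<mu> + \<delta> - \<beta> l))"
      using rem arem aS aL by (intro sum_in_bigo)
    then show ?case
      by (simp add: single_sum_def L_def R_def S_def i_def diff_divide_distrib algebra_simps)
  }
qed

end
end
section \<open>Sizes of the coupling and phase factors along the sequence\<close>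

context vanishing_scale
begin

lemma h_ln_tendsto_0: "(\<lambda>n. h n * ln (1 / h n)) \<longlonglongrightarrow> 0"
proof -
  have "filterlim (\<lambda>n. inverse (h n)) at_top sequentially"
    using h_lim h_pos by (intro filterlim_inverse_at_top) auto
  from filterlim_compose[OF ln_x_over_x_tendsto_0 this]
  show ?thesis by (simp add: field_simps)
qed

context
  fixes z :: "nat \<Rightarrow> complex" and U :: "real set" and \<gamma> :: real
  assumes U: "compact (closure U)" "closure U \<subseteq> {0<..}"
    and Re: "\<And>n. Re (z n) \<in> U"
    and Im: "(\<lambda>n. Im (z n) - (- \<gamma> * h n * ln (1 / h n))) \<in> O[sequentially](\<lambda>n. h n)"
begin

lemma Im_asymptotics:
  obtains K where "K > 0"
    "eventually (\<lambda>n. \<bar>Im (z n) + \<gamma> * h n * ln (1 / h n)\<bar> \<le> K * h n) sequentially"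
proof -
  obtain K where "K > 0"
    "eventually (\<lambda>n. norm (Im (z n) - (- \<gamma> * h n * ln (1 / h n))) \<le> K * norm (h n)) sequentially"
    using landau_o.bigE[OF Im] by blast
  then show ?thesis using h_pos by (intro that[of K]) (auto simp: abs_of_pos)
qed

text \<open>
  The lower bound rests on \<open>closure U\<close> staying away from \<open>0\<close>, the upper bound on its boundedness and
  on \<open>h log (1/h) \<rightarrow> 0\<close>.
\<close>

lemma z_bigtheta_1: "z \<in> \<Theta>(\<lambda>_. 1)"
proof -
  have Re': "Re (z n) \<in> closure U" for n using Re closure_subset by blast
  then have "closure U \<noteq> {}" by auto
  then obtain c where c: "c \<in> closure U" "\<And>t. t \<in> closure U \<Longrightarrow> c \<le> t"
    using compact_attains_inf[OF U(1)] by blast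
  obtain M where M: "\<And>t. t \<in> closure U \<Longrightarrow> \<bar>t\<bar> \<le> M"
    using compact_imp_bounded[OF U(1)] unfolding bounded_iff by auto
  have "0 < c" using U(2) c(1) by auto
  have "0 \<le> M" using M[OF c(1)] by linarith
  have "eventually (\<lambda>n. \<bar>Im (z n)\<bar> \<le> 1) sequentially"
  proof -
    obtain K where K: "K > 0"
      "eventually (\<lambda>n. \<bar>Im (z n) + \<gamma> * h n * ln (1 / h n)\<bar> \<le> K * h n) sequentially"
      by (rule Im_asymptotics)
    have "(\<lambda>n. \<bar>\<gamma>\<bar> * \<bar>h n * ln (1 / h n)\<bar> + K * h n) \<longlonglongrightarrow> \<bar>\<gamma>\<bar> * \<bar>0\<bar> + K * 0"
      by (intro tendsto_intros h_ln_tendsto_0 h_lim)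
    then have "eventually (\<lambda>n. \<bar>\<gamma>\<bar> * \<bar>h n * ln (1 / h n)\<bar> + K * h n < 1) sequentially"
      by (rule order_tendstoD) simp
    with K(2) show ?thesis
    proof eventually_elim
      case (elim n)
      have "\<bar>\<gamma> * h n * ln (1 / h n)\<bar> = \<bar>\<gamma>\<bar> * \<bar>h n * ln (1 / h n)\<bar>"
        by (simp add: abs_mult)
      with elim show ?case by linarith
    qed
  qed
  then have "eventually (\<lambda>n. c * norm (1 :: complex) \<le> norm (z n) \<and>
      norm (z n) \<le> (M + 1) * norm (1 :: complex)) sequentially"
  proof eventually_elim
    case (elim n)
    have "c \<le> Re (z n)" "\<bar>Re (z n)\<bar> \<le> M" using c(2) M Re' by auto
    then show ?case
      using elim abs_Re_le_cmod[of "z n"] cmod_le[of "z n"] by auto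
  qed
  then show ?thesis using \<open>0 < c\<close> \<open>0 \<le> M\<close> by (intro bigthetaI'[of c "M + 1"]) auto
qed

lemma coupling_bigtheta:
  assumes "C j \<noteq> 0"
  shows "(\<lambda>n. coupling C \<beta> (h n) (z n) j) \<in> \<Theta>(scale (\<beta> j))"
proof -
  define c :: complex where "c = of_real (C j) / (2 * \<i>)"
  have "c \<noteq> 0" using assms by (simp add: c_def)
  have "(\<lambda>n. scale (\<beta> j) n / z n) \<in> \<Theta>(\<lambda>n. scale (\<beta> j) n / 1)"
    by (intro bigtheta_divide bigtheta_refl z_bigtheta_1)
  then have "(\<lambda>n. c * (scale (\<beta> j) n / z n)) \<in> \<Theta>(scale (\<beta> j))"
    by (subst landau_theta.cmult_in_iff[OF \<open>c \<noteq> 0\<close>]) simp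
  moreover have "coupling C \<beta> (h n) (z n) j = c * (scale (\<beta> j) n / z n)" for n
    by (simp only: coupling_def scale_def c_def of_real_mult times_divide_times_eq)
  ultimately show ?thesis by simp
qed

text \<open>
  The logarithmic part of \<open>Im z\<close> turns the exponential growth of the plane wave into a power of
  \<open>h\<close>; the error \<open>O(h)\<close> contributes a factor bounded above and below, which is what makes the
  order exact.
\<close>

lemma phase_ratio_bigtheta:
  "(\<lambda>n. phase x (h n) (z n) l / phase x (h n) (z n) k) \<in> \<Theta>(scale (- 2 * \<gamma> * (x l - x k)))"
proof -
  define d where "d = x l - x k"
  obtain K where K: "K > 0"
    "eventually (\<lambda>n. \<bar>Im (z n) + \<gamma> * h n * ln (1 / h n)\<bar> \<le> K * h n) sequentially"
    by (rule Im_asymptotics)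
  have norm: "norm (phase x (h n) (z n) l / phase x (h n) (z n) k) =
      exp (- 2 * d * (Im (z n) + \<gamma> * h n * ln (1 / h n)) / h n) * h n powr (- 2 * \<gamma> * d)" for n
  proof -
    have "phase x (h n) (z n) l / phase x (h n) (z n) k = exp (\<i> * z n * of_real (2 * d / h n))"
      by (simp add: phase_def d_def diff_divide_distrib algebra_simps flip: exp_diff)
    then have "norm (phase x (h n) (z n) l / phase x (h n) (z n) k) = exp (- Im (z n) * (2 * d / h n))"
      by (simp add: norm_exp_eq_Re)
    also have "- Im (z n) * (2 * d / h n) =
        - 2 * d * (Im (z n) + \<gamma> * h n * ln (1 / h n)) / h n + (- 2 * \<gamma> * d) * ln (h n)"
      using h_pos[of n] by (simp add: ln_div field_simps)
    finally show ?thesis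
      using h_pos[of n] by (simp add: powr_def flip: exp_add)
  qed
  have "eventually (\<lambda>n. exp (- (2 * \<bar>d\<bar> * K)) * norm (scale (- 2 * \<gamma> * d) n)
           \<le> norm (phase x (h n) (z n) l / phase x (h n) (z n) k) \<and>
         norm (phase x (h n) (z n) l / phase x (h n) (z n) k)
           \<le> exp (2 * \<bar>d\<bar> * K) * norm (scale (- 2 * \<gamma> * d) n)) sequentially"
    using K(2)
  proof eventually_elim
    case (elim n)
    define r where "r = (Im (z n) + \<gamma> * h n * ln (1 / h n)) / h n"
    have "\<bar>r\<bar> \<le> K" using elim h_pos[of n] by (simp add: r_def field_simps)
    then have "\<bar>- 2 * d * r\<bar> \<le> 2 * \<bar>d\<bar> * K" by (simp add: abs_mult mult_left_mono)
    then have "- (2 * \<bar>d\<bar> * K) \<le> - 2 * d * r" "- 2 * d * r \<le> 2 * \<bar>d\<bar> * K" by linarith+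
    moreover have "- 2 * d * (Im (z n) + \<gamma> * h n * ln (1 / h n)) / h n = - 2 * d * r"
      by (simp add: r_def)
    ultimately show ?case unfolding norm norm_scale by (intro conjI mult_right_mono) auto
  qed
  then show ?thesis
    unfolding d_def[symmetric]
    by (intro bigthetaI'[of "exp (- (2 * \<bar>d\<bar> * K))" "exp (2 * \<bar>d\<bar> * K)"]) auto
qed

end

text \<open>
  A term of exact order \<open>h\<^sup>m\<close> cannot be compensated by terms of smaller order.
\<close>

lemma lone_leading_term_contradiction:
  assumes "finite I" "i \<in> I" "(\<lambda>n. \<Sum>j\<in>I. t j n) \<in> o(scale m)"
    and "\<And>j. j \<in> I \<Longrightarrow> j \<noteq> i \<Longrightarrow> t j \<in> o(scale m)"
    and "t i \<in> \<Theta>(scale m)"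
  shows False
proof -
  have "(\<lambda>n. \<Sum>j\<in>I - {i}. t j n) \<in> o(scale m)"
    using assms(4) by (intro big_sum_in_smallo) auto
  with assms(3) have "(\<lambda>n. (\<Sum>j\<in>I. t j n) - (\<Sum>j\<in>I - {i}. t j n)) \<in> o(scale m)"
    by (rule sum_in_smallo)
  then have "t i \<in> o(scale m)"
    using assms(1,2) by (simp add: sum_diff1)
  moreover have "scale m \<in> O(t i)"
    using assms(5) by (simp add: bigtheta_sym bigthetaD1)
  ultimately have "scale m \<in> o(scale m)"
    using landau_o.big_small_trans by blast
  then show False
    by (simp add: landau_o.small_refl_iff scale_nonzero)
qed

end

section \<open>Resonance widths are slopes\<close>

theorem theorem1:
  fixes N :: nat and x C \<beta> :: "nat \<Rightarrow> real"
    and U :: "real set" and \<gamma> :: real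
    and h :: "nat \<Rightarrow> real" and z :: "real \<Rightarrow> complex"
  assumes "N \<ge> 2"
    and "strict_mono_on {1..N} x"
    and "\<And>j. j \<in> {1..N} \<Longrightarrow> C j \<noteq> 0"
    and "\<And>j. j \<in> {1..N} \<Longrightarrow> \<beta> j > 0"
    and "unique_slopes N x \<beta>"
    and "compact (closure U)" and "closure U \<subseteq> {0<..}"
    and "\<And>n. h n > 0" and "h \<longlonglongrightarrow> 0"
    and "\<And>n. is_resonance N x C \<beta> (h n) (z (h n))"
    and "\<And>n. Re (z (h n)) \<in> U"
    and "(\<lambda>n. Im (z (h n)) - (- \<gamma> * h n * ln (1 / h n))) \<in> O[sequentially](\<lambda>n. h n)"
  shows "\<gamma> \<in> newton_slopes N x \<beta>"
proof (rule ccontr)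
  assume not_slope: "\<gamma> \<notin> newton_slopes N x \<beta>"
  interpret vanishing_scale h using assms(8,9) by unfold_locales
  define w where "w n = z (h n)" for n
  define a where "a n = coupling C \<beta> (h n) (w n)" for n
  define q where "q n = phase x (h n) (w n)" for n
  define g where "g = 2 * max \<gamma> 0"
  define \<delta> where "\<delta> = Min (\<beta> ` {1..N})"
  define f where "f k l = \<beta> k + \<beta> l - g * (x l - x k)" for k l
  \<comment> \<open>The index \<open>(0, 0)\<close>, which is no pair of scatterers, stands for the term \<open>1\<close> of the expansion and
    for the point \<open>(0, 0)\<close> of the Newton polygon. The signs are those of \<open>- left_amp\<close>.\<close>
  define I where "I = insert (0, 0) (index_pairs N)"
  define F where "F i = (if i = (0, 0) then 0 else f (fst i) (snd i))" for i
  define t where "t i = (if i = (0, 0) then (\<lambda>_. - 1) else (\<lambda>n. round_trip (a n) (q n) i))" for i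
  define m where "m = Min (F ` I)"
  have w: "\<And>n. Re (w n) \<in> U"
      "(\<lambda>n. Im (w n) - (- \<gamma> * h n * ln (1 / h n))) \<in> O[sequentially](\<lambda>n. h n)"
    using assms(11,12) by (simp_all add: w_def)
  note asym = assms(6,7) w
  have \<delta>: "\<delta> > 0" "\<And>j. j \<in> {1..N} \<Longrightarrow> \<delta> \<le> \<beta> j"
    using assms(1,4) by (auto simp: \<delta>_def)
  have zero_notin: "(0, 0) \<notin> index_pairs N" by (simp add: index_pairs_def)
  have xless: "x k < x l" if "(k, l) \<in> index_pairs N" for k l
    using that strict_mono_onD[OF assms(2), of k l] by (auto simp: index_pairs_def)
  have a_theta: "(\<lambda>n. a n j) \<in> \<Theta>(scale (\<beta> j))" if "j \<in> {1..N}" for j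
    unfolding a_def using coupling_bigtheta[OF asym] assms(3) that by blast
  have q_theta: "(\<lambda>n. q n l / q n k) \<in> \<Theta>(scale (- 2 * \<gamma> * (x l - x k)))" for k l
    unfolding q_def by (rule phase_ratio_bigtheta[OF asym])
  have q_bigo: "(\<lambda>n. q n l / q n k) \<in> O(scale (- g * (x l - x k)))" if "(k, l) \<in> index_pairs N" for k l
    using bigthetaD1[OF q_theta]
  proof (rule bigo_scale_mono)
    show "- g * (x l - x k) \<le> - 2 * \<gamma> * (x l - x k)"
      using xless[OF that] by (intro mult_right_mono) (auto simp: g_def)
  qed
  have q0: "q n j \<noteq> 0" for n j by (simp add: q_def phase_def)
  have t_bigo: "t i \<in> O(scale (F i))" if "i \<in> I" for i
  proof (cases "i = (0, 0)")
    case True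
    then show ?thesis using const_bigo_scale[of 0 "- 1"] by (simp add: t_def F_def)
  next
    case False
    then obtain k l where kl: "i = (k, l)" "(k, l) \<in> index_pairs N"
      using \<open>i \<in> I\<close> unfolding I_def by (cases i) auto
    have "(\<lambda>n. round_trip (a n) (q n) (k, l)) \<in> O(scale (\<beta> k + \<beta> l - g * (x l - x k)))"
      by (rule round_trip_bigo[where N = N and \<delta> = \<delta>])
         (use kl \<delta> assms(2) a_theta q_bigo q0 in \<open>auto simp: g_def\<close>)
    then show ?thesis using False kl by (auto simp: t_def F_def f_def)
  qed
  have "finite I" by (simp add: I_def finite_index_pairs)
  then have m_le: "m \<le> F i" if "i \<in> I" for i using that by (simp add: m_def)
  have "m \<in> F ` I" unfolding m_def using \<open>finite I\<close> by (intro Min_in) (auto simp: I_def)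
  then obtain i where i: "i \<in> I" "F i = m" by auto
  have "m \<le> 0" using m_le[of "(0, 0)"] by (simp add: I_def F_def)
  have f_le: "m \<le> f k l" if "(k, l) \<in> index_pairs N" for k l
    using m_le[of "(k, l)"] that zero_notin by (auto simp: I_def F_def split: if_splits)
  have \<gamma>_pos: "\<gamma> > 0" if "(k, l) \<in> index_pairs N" "f k l \<le> 0" for k l
  proof (rule ccontr)
    assume "\<not> \<gamma> > 0"
    then have "f k l = \<beta> k + \<beta> l" by (simp add: f_def g_def)
    moreover have "\<beta> k > 0" "\<beta> l > 0" using that(1) assms(4) by (auto simp: index_pairs_def)
    ultimately show False using that(2) by simp
  qed
  \<comment> \<open>If a pair ties with the term \<open>1\<close>, the origin and the point of the pair span an edge.\<close>
  have no_zero_pair: False if "(k, l) \<in> index_pairs N" "f k l = 0" "m = 0" for k l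
  proof -
    have "\<gamma> > 0" using \<gamma>_pos that by simp
    have f: "f k l = \<beta> k + \<beta> l - \<gamma> * (2 * (x l - x k))" for k l
      using \<open>\<gamma> > 0\<close> by (simp add: f_def g_def)
    have "\<gamma> \<in> newton_slopes N x \<beta>"
    proof (rule common_support_line_imp_slope[where m = 0])
      show "(0, 0) \<in> newton_points N x \<beta>" by (simp add: newton_points_def)
      show "(2 * (x l - x k), \<beta> k + \<beta> l) \<in> newton_points N x \<beta>"
        using that(1) by (auto simp: newton_points_def index_pairs_def)
      fix R assume "R \<in> newton_points N x \<beta>"
      then show "0 \<le> snd R - \<gamma> * fst R"
        using f_le \<open>m = 0\<close> by (auto simp: newton_points_def index_pairs_def f)
    qed (use that xless[of k l] in \<open>auto simp: f\<close>)
    then show False using not_slope by simp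
  qed
  \<comment> \<open>A tie between two pairs needs \<open>\<gamma> > 0\<close>, where \<open>f\<close> is \<open>\<nu> - \<gamma>\<lambda>\<close>.\<close>
  have unique: "j = i" if j: "j \<in> I" "F j = m" for j
  proof (cases "i = (0, 0) \<or> j = (0, 0)")
    case True
    then show ?thesis
      using i j no_zero_pair zero_notin unfolding I_def F_def
      by (cases i; cases j) (auto split: if_splits)
  next
    case False
    then obtain k l k' l' where kl: "i = (k, l)" "(k, l) \<in> index_pairs N" "j = (k', l')" "(k', l') \<in> index_pairs N"
      using i(1) j(1) unfolding I_def by (cases i; cases j) auto
    then have fm: "f k l = m" "f k' l' = m" using i(2) j(2) False by (auto simp: F_def)
    then have "\<gamma> > 0" using \<gamma>_pos kl(2) \<open>m \<le> 0\<close> by simp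
    then have f: "f k l = \<beta> k + \<beta> l - 2 * \<gamma> * (x l - x k)" for k l by (simp add: f_def g_def)
    have "k' = k \<and> l' = l"
    proof (rule unique_minimal_pair[OF assms(2,4) _ not_slope \<open>m \<le> 0\<close>])
      fix k l assume "1 \<le> k" "k < l" "l \<le> N"
      then show "m \<le> \<beta> k + \<beta> l - 2 * \<gamma> * (x l - x k)"
        using f_le[of k l] by (simp add: index_pairs_def f)
    qed (use \<open>\<gamma> > 0\<close> kl fm in \<open>auto simp: index_pairs_def f\<close>)
    then show ?thesis using kl by simp
  qed
  have "(\<lambda>n. left_amp (a n) (q n) N - (1 - sum (round_trip (a n) (q n)) (index_pairs N))) \<in> O(scale (m + \<delta>))"
  proof (rule transfer_expansion(1)[where N = N and g = g and x = x and \<beta> = \<beta>])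
    show "m \<le> \<beta> k + \<beta> l - g * (x l - x k)" if "(k, l) \<in> index_pairs N" for k l
      using f_le[OF that] by (simp add: f_def)
  qed (use \<delta> assms(2) a_theta q_bigo q0 \<open>m \<le> 0\<close> in \<open>auto simp: g_def\<close>)
  moreover have "left_amp (a n) (q n) N = 0" for n
    unfolding a_def q_def w_def by (rule resonance_imp_left_amp_eq_0[OF assms(8,2,10)])
  moreover have "(\<Sum>i\<in>I. t i n) = sum (round_trip (a n) (q n)) (index_pairs N) - 1" for n
  proof -
    have "(\<Sum>i\<in>index_pairs N. t i n) = sum (round_trip (a n) (q n)) (index_pairs N)"
      using zero_notin by (intro sum.cong) (auto simp: t_def)
    then show ?thesis
      unfolding I_def using zero_notin by (simp add: finite_index_pairs) (simp add: t_def)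
  qed
  ultimately have "(\<lambda>n. \<Sum>i\<in>I. t i n) \<in> O(scale (m + \<delta>))" by simp
  then have "(\<lambda>n. \<Sum>i\<in>I. t i n) \<in> o(scale m)"
    by (rule bigo_scale_smallo) (use \<delta> in simp)
  moreover have "t j \<in> o(scale m)" if "j \<in> I" "j \<noteq> i" for j
    using t_bigo[OF that(1)]
  proof (rule bigo_scale_smallo)
    show "m < F j" using unique[of j] m_le[of j] that by force
  qed
  \<comment> \<open>For a pair, \<open>f k l = m \<le> 0\<close> gives \<open>\<gamma> > 0\<close>, so the upper bound with \<open>g\<close> is the exact order.\<close>
  moreover have "t i \<in> \<Theta>(scale m)"
  proof (cases "i = (0, 0)")
    case True
    then have "m = 0" using i by (simp add: F_def)
    then show ?thesis using True h_pos by (simp add: t_def scale_def[abs_def] less_imp_neq[symmetric])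
  next
    case False
    then obtain k l where kl: "i = (k, l)" "(k, l) \<in> index_pairs N"
      using i(1) unfolding I_def by (cases i) auto
    have fm: "f k l = m" using i(2) kl False by (auto simp: F_def)
    then have "\<gamma> > 0" using \<gamma>_pos kl(2) \<open>m \<le> 0\<close> by simp
    have "(\<lambda>n. a n k * a n l * (q n l / q n k))
        \<in> \<Theta>(\<lambda>n. scale (\<beta> k) n * scale (\<beta> l) n * scale (- 2 * \<gamma> * (x l - x k)) n)"
      using kl(2) by (intro landau_theta.mult a_theta q_theta) (auto simp: index_pairs_def)
    also have "(\<lambda>n. scale (\<beta> k) n * scale (\<beta> l) n * scale (- 2 * \<gamma> * (x l - x k)) n) = scale m"
      using \<open>\<gamma> > 0\<close> by (simp add: fm[symmetric] f_def g_def fun_eq_iff flip: scale_add)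
    finally show ?thesis using False kl(1) by (auto simp: t_def round_trip_def)
  qed
  ultimately show False
    using lone_leading_term_contradiction[OF \<open>finite I\<close> i(1)] by blast
qed

end
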